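(* Let $(f,g)$ be an admissible pair on $\Omega$ with associated holomorphic function $A$ and constant $k$ (as defined in the context), and suppose $k=0$. Then there are constants $a,b\in\mathbb{C}$ with $a\neq0$, and real constants $C_2,D$ and $C_3,C_5\neq0$, such that, with $z=x+iy$, $f$ is the Scherk's first surface $$f=\frac{1}{|a|}\sin^{-1}\!\Big[\frac{2\,\Re\big(\frac1a e^{az+b}\big)}{C_3^2}\Big]-C_2\quad\text{on }\Omega,$$ the transformation is $$g(s)=\pm\frac{1}{|a|}\sin^{-1}\!\Big(\frac{\sin[|a|(s+C_2)]}{C_5^2}\Big)+D\quad\text{for } s\in f(\Omega),$$ and the transformed minimal graph surface is again a Scherk's first surface, given by $$g\circ f=\pm\frac{1}{|a|}\sin^{-1}\!\Big(\frac{2\,\Re\big(\frac1a e^{az+b}\big)}{(C_3C_5)^2}\Big)+D .$$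
   Context: A minimal graph surface is a smooth $f:\Omega\to\mathbb{R}$ on an open connected $\Omega\subseteq\mathbb{R}^2\cong\mathbb{C}$ satisfying $(1+f_y^2)f_{xx}-2f_{xy}f_xf_y+(1+f_x^2)f_{yy}=0$. A smooth map $g:U\to\mathbb{R}$ ($U\subseteq\mathbb{R}$ open) is a minimal graph transformation of $f$ if $f(\Omega)\subseteq U$ and $g\circ f$ is a minimal graph surface. Admissible pair: $\Omega$ is simply connected, $f:\Omega\to\mathbb{R}$ is a minimal graph surface with $\|\nabla f\|^2$ nowhere zero, $g:U\to\mathbb{R}$ is a minimal graph transformation of $f$ with $g'^3-g'$ nowhere zero on $U$, and the first characteristic function $h=\frac{g''}{g'^3-g'}$ (which satisfies $\Delta f/\|\nabla f\|^2=h(f)$) is nowhere zero on $I=f(\Omega)$. Associated $A$ and $k$: let $H_1$ be an antiderivative of $h$ on $I$ and $H$ an antiderivative of $e^{-H_1}$. Then $u=H\circ f$ is harmonic with $u_z\neq0$; write $u=A+\overline{A}$ with $A$ holomorphic on $\Omega$. The function $A$ satisfies $[\ln A'(z)]_{zz}=k\,[A'(z)]^2$, i.e. $A'''A'-(A'')^2=k(A')^4$, for a real constant $k$; the sign of $k$ (and whether $k=0$) does not depend on the choice of integration constants. A Scherk's first surface is the surface $Y=\ln\frac{\cos Z}{\cos X}$ up to rigid motion and scaling. $\sin^{-1}$ is the principal inverse sine. *)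

theory Defs
  imports "HOL-Complex_Analysis.Complex_Analysis"
begin

text \<open>The plane is identified with the type \<^typ>\<open>complex\<close>. A function given only on a set \<open>S\<close> is
  a total function whose values outside \<open>S\<close> are irrelevant; all sets \<open>S\<close> below are open, so the
  derivatives at points of \<open>S\<close> do not depend on these values.\<close>

primrec Ck_on :: "nat \<Rightarrow> 'a::real_normed_vector set \<Rightarrow> ('a \<Rightarrow> 'b::real_normed_vector) \<Rightarrow> bool" where
  "Ck_on 0 S f \<longleftrightarrow> continuous_on S f"
| "Ck_on (Suc k) S f \<longleftrightarrow>
     (\<forall>x\<in>S. f differentiable (at x)) \<and> (\<forall>v. Ck_on k S (\<lambda>x. frechet_derivative f (at x) v))"

definition smooth_on :: "'a::real_normed_vector set \<Rightarrow> ('a \<Rightarrow> 'b::real_normed_vector) \<Rightarrow> bool" where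
  "smooth_on S f \<longleftrightarrow> (\<forall>k. Ck_on k S f)"

definition dx :: "(complex \<Rightarrow> real) \<Rightarrow> complex \<Rightarrow> real" where
  "dx f z = frechet_derivative f (at z) 1"

definition dy :: "(complex \<Rightarrow> real) \<Rightarrow> complex \<Rightarrow> real" where
  "dy f z = frechet_derivative f (at z) \<i>"

definition minimal_graph :: "complex set \<Rightarrow> (complex \<Rightarrow> real) \<Rightarrow> bool" where
  "minimal_graph \<Omega> f \<longleftrightarrow> open \<Omega> \<and> connected \<Omega> \<and> smooth_on \<Omega> f \<and>
     (\<forall>z\<in>\<Omega>. (1 + (dy f z)\<^sup>2) * dx (dx f) z - 2 * dy (dx f) z * dx f z * dy f z
              + (1 + (dx f z)\<^sup>2) * dy (dy f) z = 0)"

definition minimal_graph_transformation ::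
    "complex set \<Rightarrow> (complex \<Rightarrow> real) \<Rightarrow> real set \<Rightarrow> (real \<Rightarrow> real) \<Rightarrow> bool" where
  "minimal_graph_transformation \<Omega> f U g \<longleftrightarrow>
     open U \<and> smooth_on U g \<and> f ` \<Omega> \<subseteq> U \<and> minimal_graph \<Omega> (g \<circ> f)"

definition char_fun1 :: "(real \<Rightarrow> real) \<Rightarrow> real \<Rightarrow> real" where
  "char_fun1 g s = deriv (deriv g) s / ((deriv g s) ^ 3 - deriv g s)"

definition admissible_pair ::
    "complex set \<Rightarrow> (complex \<Rightarrow> real) \<Rightarrow> real set \<Rightarrow> (real \<Rightarrow> real) \<Rightarrow> bool" where
  "admissible_pair \<Omega> f U g \<longleftrightarrow>
     simply_connected \<Omega> \<and> minimal_graph \<Omega> f \<and>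
     (\<forall>z\<in>\<Omega>. (dx f z)\<^sup>2 + (dy f z)\<^sup>2 \<noteq> 0) \<and>
     minimal_graph_transformation \<Omega> f U g \<and>
     (\<forall>s\<in>U. (deriv g s) ^ 3 - deriv g s \<noteq> 0) \<and>
     (\<forall>s\<in>f ` \<Omega>. char_fun1 g s \<noteq> 0)"

text \<open>The function \<open>A\<close> and the constant \<open>k\<close> depend on the choice of integration constants, so they
  are related to the pair by a predicate that admits every choice.\<close>

definition associated_hol ::
    "complex set \<Rightarrow> (complex \<Rightarrow> real) \<Rightarrow> (real \<Rightarrow> real) \<Rightarrow> (complex \<Rightarrow> complex) \<Rightarrow> bool" where
  "associated_hol \<Omega> f g A \<longleftrightarrow> A holomorphic_on \<Omega> \<and>
     (\<exists>H1 H :: real \<Rightarrow> real.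
        (\<forall>s\<in>f ` \<Omega>. (H1 has_real_derivative char_fun1 g s) (at s within f ` \<Omega>)) \<and>
        (\<forall>s\<in>f ` \<Omega>. (H has_real_derivative exp (- H1 s)) (at s within f ` \<Omega>)) \<and>
        (\<forall>z\<in>\<Omega>. complex_of_real (H (f z)) = A z + cnj (A z)))"

definition associated_const :: "complex set \<Rightarrow> (complex \<Rightarrow> complex) \<Rightarrow> real \<Rightarrow> bool" where
  "associated_const \<Omega> A k \<longleftrightarrow>
     (\<forall>z\<in>\<Omega>. (deriv ^^ 3) A z * deriv A z - ((deriv ^^ 2) A z)\<^sup>2 = of_real k * (deriv A z) ^ 4)"

definition graph_surface :: "complex set \<Rightarrow> (complex \<Rightarrow> real) \<Rightarrow> (real ^ 3) set" where
  "graph_surface \<Omega> f = (\<lambda>z. vector [Re z, Im z, f z]) ` \<Omega>"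

text \<open>Points \<open>(X, Y, Z)\<close> with \<open>Y = ln (cos Z / cos X)\<close>; the positivity condition is the domain of
  the formula and excludes \<open>cos X = 0\<close>, where the total division yields 0.\<close>

definition scherk1 :: "(real ^ 3) set" where
  "scherk1 = {p. cos (p $ 3) / cos (p $ 1) > 0 \<and> p $ 2 = ln (cos (p $ 3) / cos (p $ 1))}"

text \<open>A graph over an arbitrary domain is only a piece of the full surface, hence the inclusion.\<close>

definition is_scherk1 :: "(real ^ 3) set \<Rightarrow> bool" where
  "is_scherk1 S \<longleftrightarrow> (\<exists>(c::real) (R :: real ^ 3 ^ 3) (t :: real ^ 3).
     c > 0 \<and> rotation_matrix R \<and> S \<subseteq> (\<lambda>p. c *\<^sub>R (R *v p) + t) ` scherk1)"

end

theory Submission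
  imports Defs
begin

text \<open>Since \<open>k = 0\<close>, \<open>A''/A'\<close> is a constant \<open>a\<close>. The minimal surface equation for \<open>f\<close>, together with
  \<open>H \<circ> f = 2 Re A\<close>, then reads \<open>H'' = - |a|\<^sup>2 (H - c)\<close>; here \<open>a \<noteq> 0\<close>, since otherwise \<open>h = - H''/H'\<close>
  vanishes. Hence \<open>H - c\<close> is a sine with increasing phase \<open>\<theta>\<close> in \<open>(- \<pi>/2, \<pi>/2)\<close>, which can be inverted, and
  \<open>h = |a| tan \<theta>\<close>. The definition of \<open>h\<close> is the equation \<open>g'' = h (g'\<^sup>3 - g')\<close>, integrated by quadrature.
  As \<open>h \<noteq> 0\<close>, \<open>sin \<theta>\<close> has no zeros, so both graphs avoid the lines missing from the Scherk formula.\<close>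

section \<open>Derivatives of smooth functions, and images of functions without critical
  points\<close>

lemma smooth_on_differentiable:
  assumes "smooth_on S f" "x \<in> S"
  shows "f differentiable (at x)"
  using assms Ck_on.simps(2)[of 0 S f] by (auto simp: smooth_on_def simp del: Ck_on.simps)

lemma smooth_on_frechet_derivative:
  assumes "smooth_on S f"
  shows "smooth_on S (\<lambda>x. frechet_derivative f (at x) v)"
  using assms Ck_on.simps(2)[of _ S f] by (auto simp: smooth_on_def simp del: Ck_on.simps)

lemma deriv_eq_frechet_derivative:
  fixes g :: "real \<Rightarrow> real"
  assumes "g differentiable (at x)"
  shows "deriv g x = frechet_derivative g (at x) 1"
proof -
  obtain D where D: "(g has_real_derivative D) (at x)"
    using assms real_differentiable_def by blast
  then have "frechet_derivative g (at x) = (*) D"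
    by (metis frechet_derivative_at has_field_derivative_def)
  with D show ?thesis
    by (simp add: DERIV_imp_deriv)
qed

lemma smooth_on_deriv:
  fixes g :: "real \<Rightarrow> real"
  assumes "smooth_on S g" "open S" "x \<in> S"
  shows "(g has_real_derivative deriv g x) (at x)"
    and "(deriv g has_real_derivative deriv (deriv g) x) (at x)"
proof -
  have diff: "g differentiable (at y)" if "y \<in> S" for y
    using assms(1) that by (rule smooth_on_differentiable)
  then show "(g has_real_derivative deriv g x) (at x)"
    using assms(3) DERIV_deriv_iff_real_differentiable by blast
  have "(\<lambda>y. frechet_derivative g (at y) 1) differentiable (at x)"
    using smooth_on_differentiable[OF smooth_on_frechet_derivative[OF assms(1)] assms(3)] .
  then obtain D where "((\<lambda>y. frechet_derivative g (at y) 1) has_real_derivative D) (at x)"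
    using real_differentiable_def by blast
  then have "(deriv g has_real_derivative D) (at x)"
    by (rule has_field_derivative_transform_within_open[OF _ assms(2,3)])
      (simp add: diff deriv_eq_frechet_derivative)
  then show "(deriv g has_real_derivative deriv (deriv g) x) (at x)"
    by (metis DERIV_imp_deriv)
qed

lemma smooth_on_has_derivative:
  assumes "smooth_on S f" "x \<in> S"
  shows "(f has_derivative frechet_derivative f (at x)) (at x)"
  using smooth_on_differentiable[OF assms] frechet_derivative_works by blast

lemma open_image_of_submersion:
  fixes f :: "'a::euclidean_space \<Rightarrow> real"
  assumes "open S" "connected S"
    and f: "\<And>x. x \<in> S \<Longrightarrow> (f has_derivative f' x) (at x)"
    and nz: "\<And>x. x \<in> S \<Longrightarrow> f' x \<noteq> (\<lambda>v. 0)"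
  shows "open (f ` S)"
proof -
  have "continuous_on S f"
    by (meson continuous_at_imp_continuous_on f has_derivative_continuous)
  then have int: "is_interval (f ` S)"
    using assms(2) connected_continuous_image is_interval_connected_1 by blast
  have "\<exists>a b. a < f x \<and> f x < b \<and> {a<..<b} \<subseteq> f ` S" if x: "x \<in> S" for x
  proof -
    have "\<not> ((\<forall>y\<in>S. f y \<le> f x) \<or> (\<forall>y\<in>S. f x \<le> f y))"
      using differential_zero_maxmin[OF x assms(1) f[OF x]] nz[OF x] by blast
    then obtain y z where "y \<in> S" "z \<in> S" "f y < f x" "f x < f z"
      by force
    moreover have "{f y<..<f z} \<subseteq> f ` S"
    proof
      fix t assume "t \<in> {f y<..<f z}"
      then show "t \<in> f ` S"
        using mem_is_interval_1_I[OF int, of "f y" "f z" t] calculation by simp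
    qed
    ultimately show ?thesis by blast
  qed
  then have "\<exists>T. open T \<and> y \<in> T \<and> T \<subseteq> f ` S" if "y \<in> f ` S" for y
    using that by (metis greaterThanLessThan_iff imageE open_greaterThanLessThan)
  then show ?thesis
    by (subst open_subopen) blast
qed

section \<open>The minimal surface equation in terms of \<open>A\<close>\<close>

text \<open>Both sides of \<open>eq\<close> are differentiated at \<open>z\<close> and compared by
  uniqueness of the derivative. The factor \<open>w\<close> allows the same rule to be used twice:
  with \<open>w = 1\<close> for the gradient and with \<open>w\<close> a partial derivative of
  \<open>f\<close> for the Hessian.\<close>

lemma has_derivative_comp_mult_eq_Re:
  fixes f w :: "complex \<Rightarrow> real"
  assumes "open S" "z \<in> S"
    and p: "(p has_real_derivative p') (at (f z))"
    and f: "(f has_derivative Df) (at z)"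
    and w: "(w has_derivative Dw) (at z)"
    and B: "(B has_field_derivative B') (at z)"
    and eq: "\<And>\<zeta>. \<zeta> \<in> S \<Longrightarrow> p (f \<zeta>) * w \<zeta> = 2 * Re (B \<zeta>)"
  shows "p' * Df v * w z + p (f z) * Dw v = 2 * Re (B' * v)"
proof -
  have pf: "((\<lambda>\<zeta>. p (f \<zeta>)) has_derivative (\<lambda>v. p' * Df v)) (at z)"
    using has_derivative_compose[OF f] p unfolding has_field_derivative_def by blast
  have 1: "((\<lambda>\<zeta>. p (f \<zeta>) * w \<zeta>) has_derivative (\<lambda>v. p (f z) * Dw v + p' * Df v * w z)) (at z)"
    by (rule has_derivative_mult[OF pf w])
  have "((\<lambda>\<zeta>. 2 * Re (B \<zeta>)) has_derivative (\<lambda>v. 2 * Re (B' * v))) (at z)"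
    using B unfolding has_field_derivative_def by (intro has_derivative_mult_right has_derivative_Re)
  then have "((\<lambda>\<zeta>. p (f \<zeta>) * w \<zeta>) has_derivative (\<lambda>v. 2 * Re (B' * v))) (at z)"
    by (rule has_derivative_transform_within_open[OF _ assms(1,2)]) (simp add: eq)
  from has_derivative_unique[OF 1 this] show ?thesis
    by (metis add.commute)
qed

text \<open>Combining \<open>\<Delta> u = 0\<close> for \<open>u = H \<circ> f = 2 Re A\<close> with the minimal surface equation for \<open>f\<close> gives
  \<open>Hess u (\<nabla>u, \<nabla>u) = - H''(f) |\<nabla>u|\<^sup>2\<close>; in terms of \<open>A\<close>, \<open>\<nabla>u\<close> is \<open>2 cnj A'\<close> and
  \<open>Hess u (v, v) = 2 Re (A'' v\<^sup>2)\<close>.\<close>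

lemma minimal_graph_Re_holomorphic:
  assumes min: "minimal_graph \<Omega> f" and z: "z \<in> \<Omega>"
    and grad: "(dx f z)\<^sup>2 + (dy f z)\<^sup>2 \<noteq> 0"
    and A: "A holomorphic_on \<Omega>"
    and H: "\<And>s. s \<in> f ` \<Omega> \<Longrightarrow> (H has_real_derivative H' s) (at s)"
    and H': "\<And>s. s \<in> f ` \<Omega> \<Longrightarrow> (H' has_real_derivative H'' s) (at s)"
    and H'nz: "H' (f z) \<noteq> 0"
    and u: "\<And>\<zeta>. \<zeta> \<in> \<Omega> \<Longrightarrow> H (f \<zeta>) = 2 * Re (A \<zeta>)"
  shows "deriv A z \<noteq> 0"
    and "H'' (f z) * (cmod (deriv A z))\<^sup>2 = - 2 * Re (deriv (deriv A) z * (cnj (deriv A z))\<^sup>2)"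
proof -
  have \<Omega>: "open \<Omega>" and sm: "smooth_on \<Omega> f"
    and mse: "(1 + (dy f z)\<^sup>2) * dx (dx f) z - 2 * dy (dx f) z * dx f z * dy f z
              + (1 + (dx f z)\<^sup>2) * dy (dy f) z = 0"
    using min z unfolding minimal_graph_def by auto
  have dA: "(A has_field_derivative deriv A \<zeta>) (at \<zeta>)" if "\<zeta> \<in> \<Omega>" for \<zeta>
    using A \<Omega> that holomorphic_derivI by blast
  have dA': "(deriv A has_field_derivative deriv (deriv A) \<zeta>) (at \<zeta>)" if "\<zeta> \<in> \<Omega>" for \<zeta>
    using holomorphic_deriv[OF A \<Omega>] \<Omega> that holomorphic_derivI by blast
  have one: "((\<lambda>_::complex. 1::real) has_derivative (\<lambda>_. 0)) (at \<zeta>)" for \<zeta>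
    by simp
  \<comment> \<open>The case \<open>p = H\<close>, \<open>w = 1\<close>, \<open>B = A\<close>: the
    first derivatives of \<open>H \<circ> f = 2 Re A\<close>.\<close>
  have first: "H' (f \<zeta>) * frechet_derivative f (at \<zeta>) v = 2 * Re (deriv A \<zeta> * v)" if "\<zeta> \<in> \<Omega>" for \<zeta> v
    using has_derivative_comp_mult_eq_Re[OF \<Omega> that H smooth_on_has_derivative[OF sm that] one dA[OF that]]
      that u by simp
  have sm': "smooth_on \<Omega> (dx f)" "smooth_on \<Omega> (dy f)"
    using smooth_on_frechet_derivative[OF sm] unfolding dx_def dy_def by auto
  note d2 = has_derivative_comp_mult_eq_Re[OF \<Omega> z H' smooth_on_has_derivative[OF sm z]
      smooth_on_has_derivative[OF _ z]]
  \<comment> \<open>The identity \<open>first\<close> in direction \<open>1\<close> is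
    differentiated again, now with \<open>p = H'\<close> and \<open>w = dx f\<close>;
    \<open>y2\<close> does the same in direction \<open>\<i>\<close>, where the holomorphic function
    is \<open>A' \<i>\<close>.\<close>
  have x2: "H'' (f z) * frechet_derivative f (at z) v * dx f z + H' (f z) * frechet_derivative (dx f) (at z) v
      = 2 * Re (deriv (deriv A) z * v)" for v
    using d2[OF _ sm'(1) dA'[OF z]] first z by (simp add: dx_def)
  have "((\<lambda>\<zeta>. deriv A \<zeta> * \<i>) has_field_derivative deriv (deriv A) z * \<i>) (at z)"
    using DERIV_cmult_right dA' z by blast
  from d2[OF _ sm'(2) this]
  have y2: "H'' (f z) * frechet_derivative f (at z) v * dy f z + H' (f z) * frechet_derivative (dy f) (at z) v
      = 2 * Re (deriv (deriv A) z * \<i> * v)" for v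
    using first z by (simp add: dy_def)
  \<comment> \<open>With real names for all derivatives at \<open>z\<close>, the claim becomes a
    polynomial identity in real variables.\<close>
  define h k p q where "h = H' (f z)" and "k = H'' (f z)" and "p = dx f z" and "q = dy f z"
  define xx xy yy where "xx = dx (dx f) z" and "xy = dy (dx f) z" and "yy = dy (dy f) z"
  define r s m n where "r = Re (deriv (deriv A) z)" and "s = Im (deriv (deriv A) z)"
    and "m = Re (deriv A z)" and "n = Im (deriv A z)"
  note defs = h_def k_def p_def q_def xx_def xy_def yy_def r_def s_def m_def n_def
  have e1: "h * p = 2 * m" "h * q = - 2 * n"
    using first[OF z, of 1] first[OF z, of \<i>] by (simp_all add: defs dx_def dy_def)
  have e2: "k * p * p + h * xx = 2 * r" "k * q * p + h * xy = - 2 * s"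
    using x2[of 1] x2[of \<i>] by (simp_all add: defs dx_def dy_def)
  have e3: "k * q * q + h * yy = - 2 * r"
    using y2[of \<i>] by (simp add: defs dx_def dy_def)
  have e4: "(1 + q\<^sup>2) * xx - 2 * xy * p * q + (1 + p\<^sup>2) * yy = 0"
    using mse by (simp add: defs)
  have pq: "p\<^sup>2 + q\<^sup>2 \<noteq> 0" and h: "h \<noteq> 0"
    using grad H'nz by (simp_all add: defs)
  show "deriv A z \<noteq> 0"
  proof
    assume "deriv A z = 0"
    then have "p = 0" "q = 0"
      using e1 h by (simp_all add: defs)
    with pq show False by simp
  qed
  have "k * (m\<^sup>2 + n\<^sup>2) = - 2 * (r * (m\<^sup>2 - n\<^sup>2) + 2 * s * m * n)"
  proof -
    have hh: "h * xx = 2 * r - k * p * p" "h * xy = - 2 * s - k * q * p" "h * yy = - 2 * r - k * q * q"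
      using e2 e3 by simp_all
    \<comment> \<open>The minimal surface equation is multiplied by \<open>h\<close> so that the
      Hessian of \<open>f\<close> can be eliminated. The lone \<open>2 * r\<close> terms cancel
      because \<open>Re A\<close> is harmonic, and the terms \<open>k p^2 q^2\<close> cancel as
      well.\<close>
    have "(1 + q\<^sup>2) * (h * xx) - 2 * (h * xy) * p * q + (1 + p\<^sup>2) * (h * yy)
        = h * ((1 + q\<^sup>2) * xx - 2 * xy * p * q + (1 + p\<^sup>2) * yy)"
      by (simp add: algebra_simps)
    then have "(1 + q\<^sup>2) * (2 * r - k * p * p) - 2 * (- 2 * s - k * q * p) * p * q
        + (1 + p\<^sup>2) * (- 2 * r - k * q * q) = 0"
      unfolding hh e4 by simp
    then have *: "k * (p\<^sup>2 + q\<^sup>2) = - 2 * r * (p\<^sup>2 - q\<^sup>2) + 4 * s * p * q"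
      by (simp add: algebra_simps power2_eq_square)
    have m: "m = h * p / 2" "n = - h * q / 2"
      using e1 by simp_all
    have "k * (m\<^sup>2 + n\<^sup>2) = h\<^sup>2 / 4 * (k * (p\<^sup>2 + q\<^sup>2))"
      unfolding m by (simp add: field_simps power2_eq_square)
    also have "\<dots> = - 2 * (r * (m\<^sup>2 - n\<^sup>2) + 2 * s * m * n)"
      unfolding * m by (simp add: field_simps power2_eq_square)
    finally show ?thesis .
  qed
  then show "H'' (f z) * (cmod (deriv A z))\<^sup>2 = - 2 * Re (deriv (deriv A) z * (cnj (deriv A z))\<^sup>2)"
    unfolding cmod_power2 h_def[symmetric] k_def[symmetric] times_complex.sel Re_power2 Im_power2
      complex_cnj r_def[symmetric] s_def[symmetric] m_def[symmetric] n_def[symmetric] cnj.sel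
    by (simp add: algebra_simps)
qed

section \<open>The oscillator equation for \<open>H\<close>\<close>

text \<open>The energy \<open>?E\<close> is conserved and starts at zero; being a sum of squares, it
  forces both terms to vanish.\<close>

lemma harmonic_oscillator_zero:
  fixes y y' :: "real \<Rightarrow> real"
  assumes I: "open I" "connected I" "s0 \<in> I" and w: "\<omega> \<noteq> 0"
    and y: "\<And>s. s \<in> I \<Longrightarrow> (y has_real_derivative y' s) (at s)"
    and y': "\<And>s. s \<in> I \<Longrightarrow> (y' has_real_derivative - \<omega>\<^sup>2 * y s) (at s)"
    and init: "y s0 = 0" "y' s0 = 0"
    and s: "s \<in> I"
  shows "y s = 0" "y' s = 0"
proof -
  let ?E = "\<lambda>s. (y' s)\<^sup>2 + \<omega>\<^sup>2 * (y s)\<^sup>2"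
  have dE: "(?E has_real_derivative 0) (at s)" if "s \<in> I" for s
    by (rule derivative_eq_intros y[OF that] y'[OF that] refl | simp)+
  obtain c where c: "\<And>s. s \<in> I \<Longrightarrow> ?E s = c"
    using has_field_derivative_0_imp_constant_on[OF dE I(2,1)] unfolding constant_on_def by blast
  have "?E s = 0"
    using c[OF s] c[OF I(3)] init by simp
  then show "y s = 0" "y' s = 0"
    using w by (auto simp: add_nonneg_eq_0_iff)
qed

text \<open>The data at one point fix amplitude and phase, and uniqueness propagates the sine to all
  of \<open>I\<close>. As \<open>y'\<close> has no zero, the phase never meets \<open>pi / 2\<close>
  or \<open>- (pi / 2)\<close>, and connectedness keeps it between them.\<close>

lemma harmonic_oscillator_increasing:
  fixes y y' :: "real \<Rightarrow> real"
  assumes I: "open I" "connected I" "I \<noteq> {}" and w: "\<omega> > 0"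
    and y: "\<And>s. s \<in> I \<Longrightarrow> (y has_real_derivative y' s) (at s)"
    and y': "\<And>s. s \<in> I \<Longrightarrow> (y' has_real_derivative - \<omega>\<^sup>2 * y s) (at s)"
    and pos: "\<And>s. s \<in> I \<Longrightarrow> y' s > 0"
  obtains R C where "R > 0"
    "\<And>s. s \<in> I \<Longrightarrow> y s = R * sin (\<omega> * (s + C))"
    "\<And>s. s \<in> I \<Longrightarrow> y' s = R * \<omega> * cos (\<omega> * (s + C))"
    "\<And>s. s \<in> I \<Longrightarrow> - (pi / 2) < \<omega> * (s + C) \<and> \<omega> * (s + C) < pi / 2"
proof -
  obtain s0 where s0: "s0 \<in> I" using I by blast
  \<comment> \<open>\<open>R\<close> and \<open>\<theta>\<close> are polar coordinates of the
    initial data: \<open>R sin \<theta> = y s0\<close> and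
    \<open>R \<omega> cos \<theta> = y' s0\<close>. Since \<open>y' s0 > 0\<close>, the branch given
    by \<open>arcsin\<close> is the right one.\<close>
  define R where "R = sqrt ((y s0)\<^sup>2 + (y' s0 / \<omega>)\<^sup>2)"
  have y'0: "y' s0 / \<omega> > 0" using pos[OF s0] w by simp
  have R2: "R\<^sup>2 = (y s0)\<^sup>2 + (y' s0 / \<omega>)\<^sup>2"
    unfolding R_def by simp
  have R: "R > 0"
    unfolding R_def using y'0 by (intro real_sqrt_gt_zero add_nonneg_pos) auto
  define \<theta> where "\<theta> = arcsin (y s0 / R)"
  define C where "C = \<theta> / \<omega> - s0"
  have "(y s0)\<^sup>2 < R\<^sup>2" using R2 zero_less_power[OF y'0, of 2] by linarith
  then have "\<bar>y s0\<bar> < R" using R by (metis abs_le_square_iff abs_of_pos not_le)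
  then have b: "-1 < y s0 / R" "y s0 / R < 1" using R by (simp_all add: field_simps abs_less_iff)
  have \<theta>b: "- (pi / 2) < \<theta>" "\<theta> < pi / 2"
    using arcsin_lt_bounded[OF b] by (simp_all add: \<theta>_def)
  have sin: "sin \<theta> = y s0 / R" using b by (simp add: \<theta>_def)
  have cos: "cos \<theta> = y' s0 / (R * \<omega>)"
  proof -
    have "(cos \<theta>)\<^sup>2 = 1 - (y s0 / R)\<^sup>2" by (simp add: cos_squared_eq sin)
    also have "\<dots> = (R\<^sup>2 - (y s0)\<^sup>2) / R\<^sup>2" using R by (simp add: field_simps power2_eq_square)
    also have "\<dots> = (y' s0 / (R * \<omega>))\<^sup>2" unfolding R2 by (simp add: power_divide power_mult_distrib R2)
    finally have "\<bar>cos \<theta>\<bar> = \<bar>y' s0 / (R * \<omega>)\<bar>" using power2_eq_iff by (metis abs_minus_cancel)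
    moreover have "cos \<theta> > 0" using \<theta>b cos_gt_zero_pi by auto
    moreover have "y' s0 / (R * \<omega>) > 0" using pos[OF s0] R w by simp
    ultimately show ?thesis by simp
  qed
  have w0: "\<omega> * (s0 + C) = \<theta>" using w by (simp add: C_def)
  have dS: "((\<lambda>s. y s - R * sin (\<omega> * (s + C))) has_real_derivative y' s - R * \<omega> * cos (\<omega> * (s + C))) (at s)"
    if "s \<in> I" for s
    by (rule derivative_eq_intros y[OF that] refl | simp)+
  have dS': "((\<lambda>s. y' s - R * \<omega> * cos (\<omega> * (s + C))) has_real_derivative
      - \<omega>\<^sup>2 * (y s - R * sin (\<omega> * (s + C)))) (at s)"
    if "s \<in> I" for s
    by (rule derivative_eq_intros y'[OF that] refl | simp add: algebra_simps power2_eq_square)+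
  have i: "y s0 - R * sin (\<omega> * (s0 + C)) = 0" "y' s0 - R * \<omega> * cos (\<omega> * (s0 + C)) = 0"
    unfolding w0 sin cos using R w by simp_all
  have e: "y s = R * sin (\<omega> * (s + C))" "y' s = R * \<omega> * cos (\<omega> * (s + C))" if "s \<in> I" for s
    using harmonic_oscillator_zero[OF I(1,2) s0 _ dS dS' i that] w by simp_all
  have cosnz: "cos (\<omega> * (s + C)) \<noteq> 0" if "s \<in> I" for s
    using e(2)[OF that] pos[OF that] by auto
  have bd: "- (pi / 2) < \<omega> * (s + C) \<and> \<omega> * (s + C) < pi / 2" if s: "s \<in> I" for s
  proof -
    have "connected ((\<lambda>s. \<omega> * (s + C)) ` I)"
      by (intro connected_continuous_image I continuous_intros)
    then have int: "is_interval ((\<lambda>s. \<omega> * (s + C)) ` I)" (is "is_interval ?J")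
      by (simp add: is_interval_connected_1)
    have mem: "\<theta> \<in> ?J" "\<omega> * (s + C) \<in> ?J"
      using s s0 w0 by (auto intro: image_eqI[of _ _ s0])
    have "pi / 2 \<notin> ?J" "- (pi / 2) \<notin> ?J"
      using cosnz by (metis (no_types, lifting) cos_minus cos_pi_half imageE)+
    then show ?thesis
      using mem int \<theta>b unfolding is_interval_1 by (meson less_imp_le not_le)
  qed
  show thesis using that[OF R e bd] by blast
qed

section \<open>Recognising Scherk's first surface\<close>

lemma Re_complex_of_real_mult: "Re (complex_of_real c * w) = c * Re w"
  by simp

text \<open>With \<open>P = a z + l\<close> the hypothesis \<open>eq\<close> becomes
  \<open>cos Z = exp (Re P) * cos (Im P)\<close>, where \<open>Z\<close> is the scaled height
  shifted by a quarter period; this is the Scherk equation with \<open>Y = Re P\<close> and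
  \<open>X = - Im P\<close>.\<close>

lemma is_scherk1_graph_surface:
  assumes a: "a \<noteq> 0" and r: "r > 0"
    and eq: "\<And>z. z \<in> \<Omega> \<Longrightarrow> sin (cmod a * (\<phi> z - d)) = 2 * Re (1 / a * exp (a * z + b)) / r"
    and nz: "\<And>z. z \<in> \<Omega> \<Longrightarrow> sin (cmod a * (\<phi> z - d)) \<noteq> 0"
  shows "is_scherk1 (graph_surface \<Omega> \<phi>)"
proof -
  define \<omega> where "\<omega> = cmod a"
  have w: "\<omega> > 0" using a by (simp add: \<omega>_def)
  \<comment> \<open>The factor \<open>2 / (a r)\<close> and the constant \<open>b\<close> are
    absorbed into one exponent.\<close>
  define l where "l = Ln (2 / (a * of_real r) * exp b)"
  have l: "exp l = 2 / (a * of_real r) * exp b" unfolding l_def using a r by simp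
  define ca sa where "ca = Re a / \<omega>" and "sa = Im a / \<omega>"
  have aeq: "Re a = \<omega> * ca" "Im a = \<omega> * sa" using w by (simp_all add: ca_def sa_def)
  have one: "ca\<^sup>2 + sa\<^sup>2 = 1"
    unfolding ca_def sa_def using w a
    by (simp add: power_divide add_divide_distrib[symmetric] cmod_power2[symmetric] \<omega>_def)
  \<comment> \<open>Horizontally, \<open>Q\<close> followed by the scaling
    \<open>1 / \<omega>\<close> sends \<open>(- Im P, Re P)\<close> to
    \<open>P / a = z + l / a\<close>. The translation \<open>t\<close> removes \<open>l / a\<close>
    and undoes the vertical shift.\<close>
  define Q :: "real^3^3" where "Q = vector [vector [- sa, ca, 0], vector [- ca, - sa, 0], vector [0, 0, 1]]"
  define t :: "real^3" where "t = vector [(- sa * Im l - ca * Re l) / \<omega>, (- ca * Im l + sa * Re l) / \<omega>, d + pi / (2 * \<omega>)]"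
  have Q: "rotation_matrix Q"
    unfolding rotation_matrix_def orthogonal_matrix det_3 Q_def
    using one
    by (auto simp: vec_eq_iff forall_3 matrix_matrix_mult_def transpose_def mat_def sum_3 power2_eq_square algebra_simps)
  have "vector [Re z, Im z, \<phi> z] \<in> (\<lambda>p. (1 / \<omega>) *\<^sub>R (Q *v p) + t) ` scherk1" if z: "z \<in> \<Omega>" for z
  proof -
    define P where "P = a * z + l"
    \<comment> \<open>The sign of the first coordinate, harmless since \<open>cos\<close> is even, makes \<open>Q\<close> orientation preserving.\<close>
    define q :: "real^3" where "q = vector [- Im P, Re P, \<omega> * (\<phi> z - d) - pi / 2]"
    have cosZ: "cos (\<omega> * (\<phi> z - d) - pi / 2) = sin (\<omega> * (\<phi> z - d))"
      by (simp add: cos_diff)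
    have "2 * Re (1 / a * exp (a * z + b)) / r = Re (of_real (2 / r) * (1 / a * exp (a * z + b)))"
      unfolding Re_complex_of_real_mult by simp
    also have "of_real (2 / r) * (1 / a * exp (a * z + b)) = exp P"
      unfolding P_def exp_add l using a r by (simp add: field_simps)
    also have "Re (exp P) = exp (Re P) * cos (Im P)" by (rule Re_exp)
    finally have s: "sin (\<omega> * (\<phi> z - d)) = exp (Re P) * cos (Im P)"
      using eq[OF z] unfolding \<omega>_def by simp
    \<comment> \<open>Now the quotient in \<open>scherk1\<close> equals \<open>exp (Re P)\<close>,
      so it is positive and its logarithm is \<open>Re P\<close>.\<close>
    then have "cos (Im P) \<noteq> 0" using nz[OF z] unfolding \<omega>_def by auto
    then have "q \<in> scherk1"
      unfolding scherk1_def q_def using s by (simp add: cosZ)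
    moreover have "vector [Re z, Im z, \<phi> z] = (1 / \<omega>) *\<^sub>R (Q *v q) + t"
    proof -
      have "Re z = (- sa * (- Im P) + ca * Re P) / \<omega> + (- sa * Im l - ca * Re l) / \<omega>"
        "Im z = (- ca * (- Im P) - sa * Re P) / \<omega> + (- ca * Im l + sa * Re l) / \<omega>"
        "\<phi> z = (\<omega> * (\<phi> z - d) - pi / 2) / \<omega> + (d + pi / (2 * \<omega>))"
      proof -
        have "- sa * (- Im P) + ca * Re P + (- sa * Im l - ca * Re l) = \<omega> * (ca\<^sup>2 + sa\<^sup>2) * Re z"
          by (simp add: P_def aeq algebra_simps power2_eq_square)
        then show "Re z = (- sa * (- Im P) + ca * Re P) / \<omega> + (- sa * Im l - ca * Re l) / \<omega>"
          unfolding add_divide_distrib[symmetric] using w one by simp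
        have "- ca * (- Im P) - sa * Re P + (- ca * Im l + sa * Re l) = \<omega> * (ca\<^sup>2 + sa\<^sup>2) * Im z"
          by (simp add: P_def aeq algebra_simps power2_eq_square)
        then show "Im z = (- ca * (- Im P) - sa * Re P) / \<omega> + (- ca * Im l + sa * Re l) / \<omega>"
          unfolding add_divide_distrib[symmetric] using w one by simp
        show "\<phi> z = (\<omega> * (\<phi> z - d) - pi / 2) / \<omega> + (d + pi / (2 * \<omega>))"
          using w by (simp add: field_simps)
      qed
      then show ?thesis
        unfolding vec_eq_iff forall_3
        by (simp add: Q_def q_def t_def matrix_vector_mult_def sum_3)
    qed
    ultimately show ?thesis by blast
  qed
  then show ?thesis
    unfolding is_scherk1_def graph_surface_def
    by (intro exI[of _ "1 / \<omega>"] exI[of _ Q] exI[of _ t] conjI Q) (use w in auto)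
qed

section \<open>The equation for the transformation\<close>

text \<open>\<open>(1 / g'\<^sup>2 - 1) cos\<^sup>2\<close> is a first integral of the equation for \<open>g\<close>.\<close>

lemma transformation_ode_solution:
  fixes g g' g'' h :: "real \<Rightarrow> real" and \<omega> C :: real
  defines "\<theta> \<equiv> \<lambda>s. \<omega> * (s + C)"
  assumes I: "open I" "connected I" "I \<noteq> {}" and w: "\<omega> > 0"
    and g: "\<And>s. s \<in> I \<Longrightarrow> (g has_real_derivative g' s) (at s)"
    and g': "\<And>s. s \<in> I \<Longrightarrow> (g' has_real_derivative g'' s) (at s)"
    and g'nz: "\<And>s. s \<in> I \<Longrightarrow> g' s \<noteq> 0"
    and ode: "\<And>s. s \<in> I \<Longrightarrow> g'' s * cos (\<theta> s) = (g' s ^ 3 - g' s) * (\<omega> * sin (\<theta> s))"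
    and cos: "\<And>s. s \<in> I \<Longrightarrow> cos (\<theta> s) > 0"
  obtains M \<epsilon> D where "M > 0" "\<epsilon> \<in> {1, -1}"
    "\<And>s. s \<in> I \<Longrightarrow> \<bar>sin (\<theta> s)\<bar> < M"
    "\<And>s. s \<in> I \<Longrightarrow> g s = \<epsilon> / \<omega> * arcsin (sin (\<theta> s) / M) + D"
proof -
  obtain s0 where s0: "s0 \<in> I" using I by blast
  let ?K = "\<lambda>s. (1 / (g' s)\<^sup>2 - 1) * (cos (\<theta> s))\<^sup>2"
  have d\<theta>: "(\<theta> has_real_derivative \<omega>) (at s)" for s
    unfolding \<theta>_def by (rule derivative_eq_intros refl | simp)+
  have "(?K has_real_derivative 0) (at s)" if s: "s \<in> I" for s
  proof -
    have nz: "g' s \<noteq> 0" by (rule g'nz[OF s])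
    have "(?K has_real_derivative
        - (2 * g'' s / (g' s)^3) * (cos (\<theta> s))\<^sup>2 - (1 / (g' s)\<^sup>2 - 1) * (2 * cos (\<theta> s) * (sin (\<theta> s) * \<omega>))) (at s)"
      by (rule derivative_eq_intros g'[OF s] d\<theta> refl | simp add: nz)+
        (simp add: nz field_simps power2_eq_square power3_eq_cube power4_eq_xxxx)
    moreover have "- (2 * g'' s / (g' s)^3) * (cos (\<theta> s))\<^sup>2 - (1 / (g' s)\<^sup>2 - 1) * (2 * cos (\<theta> s) * (sin (\<theta> s) * \<omega>)) = 0"
    proof -
      have "- (2 * g'' s / (g' s)^3) * (cos (\<theta> s))\<^sup>2 = - (2 / (g' s)^3) * cos (\<theta> s) * (g'' s * cos (\<theta> s))"
        by (simp add: power2_eq_square)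
      also have "\<dots> = (1 / (g' s)\<^sup>2 - 1) * (2 * cos (\<theta> s) * (sin (\<theta> s) * \<omega>))"
        unfolding ode[OF s] using nz by (simp add: field_simps power2_eq_square power3_eq_cube)
      finally show ?thesis by simp
    qed
    ultimately show ?thesis by (simp only:)
  qed
  from has_field_derivative_0_imp_constant_on[OF this I(2,1)]
  obtain K where K: "\<And>s. s \<in> I \<Longrightarrow> ?K s = K"
    unfolding constant_on_def by blast
  have K2: "(cos (\<theta> s))\<^sup>2 / (g' s)\<^sup>2 = 1 + K - (sin (\<theta> s))\<^sup>2" if "s \<in> I" for s
    using K[OF that] by (simp add: left_diff_distrib cos_squared_eq diff_divide_distrib)
  have pos: "1 + K - (sin (\<theta> s))\<^sup>2 > 0" if "s \<in> I" for s
    using K2[OF that] cos[OF that] g'nz[OF that] by (metis divide_pos_pos less_irrefl zero_less_power2)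
  \<comment> \<open>By \<open>K2\<close>, the square of \<open>g'\<close> is
    \<open>cos^2 / (M^2 - sin^2)\<close>; thus \<open>g'\<close> is, up to sign, the derivative of
    \<open>arcsin (sin (\<theta> s) / M) / \<omega>\<close>.\<close>
  define M where "M = sqrt (1 + K)"
  have "1 + K > 0" using pos[OF s0] by (smt (verit) zero_le_power2)
  then have M: "M > 0" and M2: "M\<^sup>2 = 1 + K" by (simp_all add: M_def)
  have sM: "\<bar>sin (\<theta> s)\<bar> < M" if "s \<in> I" for s
    using pos[OF that] M M2 by (metis abs_le_square_iff abs_of_pos diff_gt_0_iff_gt not_le)
  define \<epsilon> where "\<epsilon> = sgn (g' s0)"
  have \<epsilon>: "\<epsilon> \<in> {1, -1}" using g'nz[OF s0] by (auto simp: \<epsilon>_def sgn_if)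
  \<comment> \<open>A continuous \<open>g'\<close> without zeros keeps its sign on the connected set
    \<open>I\<close>, so a single \<open>\<epsilon>\<close> serves everywhere.\<close>
  have sgn: "sgn (g' s) = \<epsilon>" if s: "s \<in> I" for s
  proof -
    have "continuous_on I g'" by (meson DERIV_isCont continuous_at_imp_continuous_on g')
    then have "is_interval (g' ` I)"
      using I connected_continuous_image is_interval_connected_1 by blast
    moreover have "0 \<notin> g' ` I" using g'nz by auto
    ultimately have "\<not> (g' s < 0 \<and> g' s0 > 0)" "\<not> (g' s > 0 \<and> g' s0 < 0)"
      unfolding is_interval_1 using s s0 by (meson imageI less_imp_le)+
    then show ?thesis using g'nz[OF s] g'nz[OF s0] by (auto simp: \<epsilon>_def sgn_if)
  qed
  have g'eq: "g' s = \<epsilon> * (cos (\<theta> s) / sqrt (M\<^sup>2 - (sin (\<theta> s))\<^sup>2))" if s: "s \<in> I" for s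
  proof -
    have "(g' s)\<^sup>2 = (cos (\<theta> s))\<^sup>2 / (M\<^sup>2 - (sin (\<theta> s))\<^sup>2)"
      using K2[OF s] pos[OF s] g'nz[OF s] M2 cos[OF s] by (simp add: field_simps)
    then have "\<bar>g' s\<bar> = cos (\<theta> s) / sqrt (M\<^sup>2 - (sin (\<theta> s))\<^sup>2)"
      using cos[OF s] by (metis abs_of_pos real_sqrt_abs real_sqrt_divide)
    then show ?thesis using sgn[OF s] by (metis sgn_mult_abs)
  qed
  have "((\<lambda>s. g s - \<epsilon> / \<omega> * arcsin (sin (\<theta> s) / M)) has_real_derivative 0) (at s)" if s: "s \<in> I" for s
  proof -
    have b: "-1 < sin (\<theta> s) / M" "sin (\<theta> s) / M < 1"
      using sM[OF s] M by (simp_all add: field_simps abs_less_iff)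
    have "sqrt (1 - (sin (\<theta> s) / M)\<^sup>2) = sqrt ((M\<^sup>2 - (sin (\<theta> s))\<^sup>2) / M\<^sup>2)"
      using M by (simp add: field_simps)
    also have "\<dots> = sqrt (M\<^sup>2 - (sin (\<theta> s))\<^sup>2) / M"
      using M by (simp add: real_sqrt_divide)
    finally have sq: "sqrt (1 - (sin (\<theta> s) / M)\<^sup>2) = sqrt (M\<^sup>2 - (sin (\<theta> s))\<^sup>2) / M" .
    have p: "sqrt (M\<^sup>2 - (sin (\<theta> s))\<^sup>2) > 0" using pos[OF s] M2 by simp
    have "((\<lambda>s. sin (\<theta> s) / M) has_real_derivative cos (\<theta> s) * \<omega> / M) (at s)"
      by (intro DERIV_cdivide DERIV_chain2[OF DERIV_sin d\<theta>])
    from DERIV_chain2[OF DERIV_arcsin[OF b] this]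
    have "((\<lambda>s. arcsin (sin (\<theta> s) / M)) has_real_derivative
        inverse (sqrt (1 - (sin (\<theta> s) / M)\<^sup>2)) * (cos (\<theta> s) * \<omega> / M)) (at s)" .
    from DERIV_diff[OF g[OF s] DERIV_cmult[OF this, of "\<epsilon> / \<omega>"]]
    show ?thesis
      unfolding sq g'eq[OF s] using M w p by (simp add: field_simps)
  qed
  from has_field_derivative_0_imp_constant_on[OF this I(2,1)]
  obtain D where "\<And>s. s \<in> I \<Longrightarrow> g s - \<epsilon> / \<omega> * arcsin (sin (\<theta> s) / M) = D"
    unfolding constant_on_def by blast
  then have "\<And>s. s \<in> I \<Longrightarrow> g s = \<epsilon> / \<omega> * arcsin (sin (\<theta> s) / M) + D"
    by (metis add.commute diff_add_cancel)
  with M \<epsilon> sM that show thesis by blast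
qed

section \<open>The exponential form of \<open>A'\<close>\<close>

text \<open>For \<open>k = 0\<close> the defining identity says that the numerator of the derivative
  of \<open>A'' / A'\<close> vanishes.\<close>

lemma holomorphic_log_derivative_const:
  assumes S: "open S" "connected S" and A: "A holomorphic_on S"
    and nz: "\<And>z. z \<in> S \<Longrightarrow> deriv A z \<noteq> 0"
    and k0: "associated_const S A 0"
  obtains a where "\<And>z. z \<in> S \<Longrightarrow> deriv (deriv A) z = a * deriv A z"
proof -
  have hol: "deriv A holomorphic_on S" "deriv (deriv A) holomorphic_on S"
    using A S holomorphic_deriv by blast+
  have "((\<lambda>z. deriv (deriv A) z / deriv A z) has_field_derivative 0) (at z)" if z: "z \<in> S" for z
  proof -
    have "deriv (deriv (deriv A)) z * deriv A z - deriv (deriv A) z * deriv (deriv A) z = 0"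
      using k0 z unfolding associated_const_def by (simp add: numeral_3_eq_3 numeral_2_eq_2)
    then show ?thesis
      using DERIV_divide[OF holomorphic_derivI[OF hol(2) S(1) z] holomorphic_derivI[OF hol(1) S(1) z] nz[OF z]]
      by simp
  qed
  from has_field_derivative_0_imp_constant_on[OF this S(2,1)]
  obtain a where "\<And>z. z \<in> S \<Longrightarrow> deriv (deriv A) z / deriv A z = a"
    unfolding constant_on_def by blast
  then show thesis
    using that nz by (metis nonzero_divide_eq_eq)
qed

text \<open>The integrating factor \<open>exp (- a * z)\<close> makes the product constant; this
  constant is nonzero, so \<open>Ln\<close> moves it into the exponent.\<close>

lemma exp_of_log_derivative_const:
  assumes S: "open S" "connected S" "S \<noteq> {}"
    and B: "\<And>z. z \<in> S \<Longrightarrow> (B has_field_derivative a * B z) (at z)"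
    and nz: "\<And>z. z \<in> S \<Longrightarrow> B z \<noteq> 0"
  obtains b :: complex where "\<And>z. z \<in> S \<Longrightarrow> B z = exp (a * z + b)"
proof -
  have "((\<lambda>z. B z * exp (- a * z)) has_field_derivative 0) (at z)" if "z \<in> S" for z
    by (rule derivative_eq_intros B[OF that] refl | simp)+
  from has_field_derivative_0_imp_constant_on[OF this S(2,1)]
  obtain c where c: "\<And>z. z \<in> S \<Longrightarrow> B z * exp (- a * z) = c"
    unfolding constant_on_def by blast
  have "c \<noteq> 0" using c nz S(3) by fastforce
  then have "B z = exp (a * z + Ln c)" if "z \<in> S" for z
    using c[OF that] by (simp add: exp_add exp_minus field_simps)
  then show thesis using that by blast
qed

section \<open>Explicit form of \<open>f\<close> and \<open>g\<close> when
  \<open>k = 0\<close>\<close>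

theorem mainTheorem4:
  fixes \<Omega> :: "complex set" and f :: "complex \<Rightarrow> real"
    and U :: "real set" and g :: "real \<Rightarrow> real"
    and A :: "complex \<Rightarrow> complex" and k :: real
  assumes "admissible_pair \<Omega> f U g"
    and "associated_hol \<Omega> f g A"
    and "associated_const \<Omega> A k"
    and "k = 0"
  shows "\<exists>(a::complex) (b::complex) (C2::real) (D::real) (C3::real) (C5::real) (\<epsilon>::real).
    a \<noteq> 0 \<and> C3 \<noteq> 0 \<and> C5 \<noteq> 0 \<and> \<epsilon> \<in> {1, -1} \<and>
    (\<forall>z\<in>\<Omega>. 2 * Re (1 / a * exp (a * z + b)) / C3\<^sup>2 \<in> {-1..1} \<and>
       f z = 1 / cmod a * arcsin (2 * Re (1 / a * exp (a * z + b)) / C3\<^sup>2) - C2) \<and>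
    is_scherk1 (graph_surface \<Omega> f) \<and>
    (\<forall>s\<in>f ` \<Omega>. sin (cmod a * (s + C2)) / C5\<^sup>2 \<in> {-1..1} \<and>
       g s = \<epsilon> * (1 / cmod a) * arcsin (sin (cmod a * (s + C2)) / C5\<^sup>2) + D) \<and>
    (\<forall>z\<in>\<Omega>. 2 * Re (1 / a * exp (a * z + b)) / (C3 * C5)\<^sup>2 \<in> {-1..1} \<and>
       (g \<circ> f) z =
         \<epsilon> * (1 / cmod a) * arcsin (2 * Re (1 / a * exp (a * z + b)) / (C3 * C5)\<^sup>2) + D) \<and>
    is_scherk1 (graph_surface \<Omega> (g \<circ> f))"
\<comment> \<open>The definitions admit the empty domain, where only the sign conditions on the
  constants have content. Otherwise a base point is available for the integrations.\<close>
proof (cases "\<Omega> = {}")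
  case True
  then show ?thesis
    using is_scherk1_graph_surface[of 1 1 "{}"]
    by (intro exI[of _ 1] exI[of _ 0]) auto
next
  case False
  define I where "I = f ` \<Omega>"
  define h where "h = char_fun1 g"
  from assms(1) have min: "minimal_graph \<Omega> f"
    and grad: "\<And>z. z \<in> \<Omega> \<Longrightarrow> (dx f z)\<^sup>2 + (dy f z)\<^sup>2 \<noteq> 0"
    and U: "open U" "smooth_on U g" "I \<subseteq> U"
    and g3: "\<And>s. s \<in> U \<Longrightarrow> (deriv g s) ^ 3 - deriv g s \<noteq> 0"
    and hnz: "\<And>s. s \<in> I \<Longrightarrow> h s \<noteq> 0"
    unfolding admissible_pair_def minimal_graph_transformation_def I_def h_def by blast+
  from min have \<Omega>: "open \<Omega>" "connected \<Omega>" and sm: "smooth_on \<Omega> f"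
    unfolding minimal_graph_def by blast+
  have fd: "(f has_derivative frechet_derivative f (at z)) (at z)" if "z \<in> \<Omega>" for z
    by (rule smooth_on_has_derivative[OF sm that])
  have "frechet_derivative f (at z) \<noteq> (\<lambda>v. 0)" if "z \<in> \<Omega>" for z
    using grad[OF that] unfolding dx_def dy_def by auto
  from open_image_of_submersion[OF \<Omega> fd this] have "open I"
    by (simp add: I_def)
  moreover have "connected I"
    unfolding I_def
    by (intro connected_continuous_image \<Omega> continuous_at_imp_continuous_on ballI has_derivative_continuous[OF fd])
  moreover have "I \<noteq> {}" using False by (simp add: I_def)
  ultimately have I: "open I" "connected I" "I \<noteq> {}" .

  from assms(2) obtain H1 H where A: "A holomorphic_on \<Omega>"
    and H1: "\<And>s. s \<in> I \<Longrightarrow> (H1 has_real_derivative h s) (at s)"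
    and H: "\<And>s. s \<in> I \<Longrightarrow> (H has_real_derivative exp (- H1 s)) (at s)"
    and "\<And>z. z \<in> \<Omega> \<Longrightarrow> complex_of_real (H (f z)) = A z + cnj (A z)"
    unfolding associated_hol_def I_def[symmetric] h_def[symmetric]
    using at_within_open[OF _ I(1)] by metis
  then have u: "H (f z) = 2 * Re (A z)" if "z \<in> \<Omega>" for z
    using that by (metis complex_add_cnj of_real_eq_iff)
  have H': "((\<lambda>s. exp (- H1 s)) has_real_derivative - h s * exp (- H1 s)) (at s)" if "s \<in> I" for s
    by (rule derivative_eq_intros H1[OF that] refl | simp)+
  \<comment> \<open>Here the first derivative of \<open>H\<close> is \<open>exp (- H1)\<close>,
    which is never zero, and the second is \<open>- h * exp (- H1)\<close>.\<close>
  have A'nz: "deriv A z \<noteq> 0"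
    and key: "- h (f z) * exp (- H1 (f z)) * (cmod (deriv A z))\<^sup>2
      = - 2 * Re (deriv (deriv A) z * (cnj (deriv A z))\<^sup>2)" if "z \<in> \<Omega>" for z
    using minimal_graph_Re_holomorphic[OF min that grad[OF that] A H[unfolded I_def] H'[unfolded I_def] _ u]
    by simp_all
  obtain a where a: "\<And>z. z \<in> \<Omega> \<Longrightarrow> deriv (deriv A) z = a * deriv A z"
    using holomorphic_log_derivative_const[OF \<Omega> A A'nz] assms(3,4) by blast
  \<comment> \<open>Substituting \<open>A'' = a A'\<close> into \<open>key\<close> produces a factor
    \<open>|A'|^2\<close> on both sides, which cancels.\<close>
  have H'': "- h (f z) * exp (- H1 (f z)) = - 2 * Re (a * cnj (deriv A z))" if z: "z \<in> \<Omega>" for z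
  proof -
    let ?B = "deriv A z"
    have "a * ?B * (cnj ?B)\<^sup>2 = of_real ((cmod ?B)\<^sup>2) * (a * cnj ?B)"
      unfolding complex_norm_square by (simp add: power2_eq_square)
    then have e: "Re (a * ?B * (cnj ?B)\<^sup>2) = (cmod ?B)\<^sup>2 * Re (a * cnj ?B)"
      by (metis Re_complex_of_real_mult)
    from key[OF z] have "(- h (f z) * exp (- H1 (f z))) * (cmod ?B)\<^sup>2 = (- 2 * Re (a * cnj ?B)) * (cmod ?B)\<^sup>2"
      unfolding a[OF z] e by (simp only: ac_simps)
    then show ?thesis using A'nz[OF z] by (subst (asm) mult_right_cancel) simp_all
  qed
  have anz: "a \<noteq> 0"
  proof
    assume "a = 0"
    with H'' False hnz show False unfolding I_def by fastforce
  qed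
  have dA: "(A has_field_derivative deriv A z) (at z)"
    and dA': "(deriv A has_field_derivative a * deriv A z) (at z)" if "z \<in> \<Omega>" for z
    using holomorphic_derivI[OF A \<Omega>(1) that] holomorphic_derivI[OF holomorphic_deriv[OF A \<Omega>(1)] \<Omega>(1) that] a[OF that]
    by auto
  obtain b where b: "\<And>z. z \<in> \<Omega> \<Longrightarrow> deriv A z = exp (a * z + b)"
    using exp_of_log_derivative_const[OF \<Omega> False dA' A'nz] by blast
  \<comment> \<open>Since \<open>A'' = a A'\<close> with \<open>a \<noteq> 0\<close>,
    \<open>A' / a\<close> is another primitive of \<open>A'\<close>.\<close>
  have "((\<lambda>z. A z - deriv A z / a) has_field_derivative 0) (at z)" if "z \<in> \<Omega>" for z
    by (rule derivative_eq_intros dA[OF that] dA'[OF that] refl | simp add: anz)+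
  from has_field_derivative_0_imp_constant_on[OF this \<Omega>(2,1)]
  obtain c where c: "\<And>z. z \<in> \<Omega> \<Longrightarrow> A z - deriv A z / a = c"
    unfolding constant_on_def by blast
  define E where "E = (\<lambda>z. 2 * Re (1 / a * exp (a * z + b)))"
  define c0 where "c0 = 2 * Re c"
  have HE: "H (f z) - c0 = E z" if "z \<in> \<Omega>" for z
  proof -
    have "A z = 1 / a * exp (a * z + b) + c"
      using c[OF that] b[OF that] by (simp add: algebra_simps)
    then show ?thesis unfolding u[OF that] c0_def E_def by simp
  qed
  define \<omega> where "\<omega> = cmod a"
  have w: "\<omega> > 0" using anz by (simp add: \<omega>_def)
  \<comment> \<open>Conjugating inside the real part turns \<open>a * cnj A'\<close> into
    \<open>|a|^2 A' / a\<close>, whose real part is \<open>|a|^2 (H - c0) / 2\<close>. The result is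
    an equation in \<open>s\<close> alone.\<close>
  have h_eq: "- h s * exp (- H1 s) = - \<omega>\<^sup>2 * (H s - c0)" if "s \<in> I" for s
  proof -
    from that obtain z where z: "z \<in> \<Omega>" "s = f z" unfolding I_def by blast
    have "Re (a * cnj (deriv A z)) = Re (cnj (a * cnj (deriv A z)))" by (simp only: cnj.sel)
    also have "cnj (a * cnj (deriv A z)) = of_real (\<omega>\<^sup>2) * (1 / a * exp (a * z + b))"
      unfolding \<omega>_def complex_norm_square using anz b[OF z(1)] by simp
    finally have "Re (a * cnj (deriv A z)) = \<omega>\<^sup>2 * (E z / 2)"
      unfolding Re_complex_of_real_mult by (simp add: E_def)
    with H''[OF z(1)] show ?thesis unfolding z(2) HE[OF z(1)] by simp
  qed
  \<comment> \<open>The oscillator has displacement \<open>H - c0\<close> and velocity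
    \<open>exp (- H1)\<close>, which is positive as an exponential.\<close>
  have "((\<lambda>s. H s - c0) has_real_derivative exp (- H1 s)) (at s)" if "s \<in> I" for s
    by (rule derivative_eq_intros H[OF that] refl | simp)+
  moreover have "((\<lambda>s. exp (- H1 s)) has_real_derivative - \<omega>\<^sup>2 * (H s - c0)) (at s)" if "s \<in> I" for s
    using H'[OF that] h_eq[OF that] by metis
  ultimately obtain R C where R: "R > 0"
    and sinR: "\<And>s. s \<in> I \<Longrightarrow> H s - c0 = R * sin (\<omega> * (s + C))"
    and cosR: "\<And>s. s \<in> I \<Longrightarrow> exp (- H1 s) = R * \<omega> * cos (\<omega> * (s + C))"
    and range: "\<And>s. s \<in> I \<Longrightarrow> - (pi / 2) < \<omega> * (s + C) \<and> \<omega> * (s + C) < pi / 2"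
    using harmonic_oscillator_increasing[OF I w, of "\<lambda>s. H s - c0" "\<lambda>s. exp (- H1 s)"] by (metis exp_gt_zero)
  define \<theta> where "\<theta> = (\<lambda>s. \<omega> * (s + C))"
  have cos: "cos (\<theta> s) > 0" if "s \<in> I" for s
    unfolding \<theta>_def using range[OF that] by (intro cos_gt_zero_pi) auto
  \<comment> \<open>This is \<open>h = - H'' / H' = \<omega> tan \<theta>\<close>, cleared of
    denominators.\<close>
  have hcos: "h s * cos (\<theta> s) = \<omega> * sin (\<theta> s)" if "s \<in> I" for s
  proof -
    have "(R * \<omega>) * (h s * cos (\<theta> s)) = (R * \<omega>) * (\<omega> * sin (\<theta> s))"
      using h_eq[OF that] unfolding sinR[OF that] cosR[OF that] \<theta>_def by (simp add: power2_eq_square)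
    then show ?thesis using R w by simp
  qed
  have sinnz: "sin (\<theta> s) \<noteq> 0" if "s \<in> I" for s
    using hcos[OF that] hnz[OF that] cos[OF that] by auto
  have sinE: "sin (\<theta> (f z)) = E z / R" if "z \<in> \<Omega>" for z
    using sinR[of "f z"] HE[OF that] that R by (simp add: I_def \<theta>_def)
  have f_eq: "f z = 1 / \<omega> * arcsin (E z / R) - C" if "z \<in> \<Omega>" for z
  proof -
    have "arcsin (E z / R) = \<theta> (f z)"
      unfolding sinE[OF that, symmetric]
      using range[of "f z"] that by (intro arcsin_sin) (auto simp: I_def \<theta>_def)
    then show ?thesis using w by (simp add: \<theta>_def)
  qed

  have gd: "(g has_real_derivative deriv g s) (at s)"
    "(deriv g has_real_derivative deriv (deriv g) s) (at s)"
    "deriv g s \<noteq> 0" if "s \<in> I" for s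
    using smooth_on_deriv[OF U(2,1)] g3[of s] that U(3) by auto
  have ode: "deriv (deriv g) s * cos (\<omega> * (s + C)) = (deriv g s ^ 3 - deriv g s) * (\<omega> * sin (\<omega> * (s + C)))"
    if "s \<in> I" for s
  proof -
    have "deriv (deriv g) s = (deriv g s ^ 3 - deriv g s) * h s"
      using g3[of s] that U(3) unfolding h_def char_fun1_def by auto
    then show ?thesis using hcos[OF that] by (simp add: \<theta>_def)
  qed
  obtain M \<epsilon> D where M: "M > 0" and \<epsilon>: "\<epsilon> \<in> {1, -1}"
    and sM: "\<And>s. s \<in> I \<Longrightarrow> \<bar>sin (\<theta> s)\<bar> < M"
    and g_eq: "\<And>s. s \<in> I \<Longrightarrow> g s = \<epsilon> / \<omega> * arcsin (sin (\<theta> s) / M) + D"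
    using transformation_ode_solution[OF I w gd(1,2,3) ode cos[unfolded \<theta>_def]]
    unfolding \<theta>_def by blast
  have sM1: "\<bar>sin (\<theta> s) / M\<bar> \<le> 1" if "s \<in> I" for s
    using sM[OF that] M by simp
  \<comment> \<open>On the graph \<open>sin \<theta> = E / R\<close>, so the two denominators
    multiply.\<close>
  have gf_eq: "g (f z) = \<epsilon> / \<omega> * arcsin (E z / (R * M)) + D" if "z \<in> \<Omega>" for z
    using g_eq[of "f z"] sinE[OF that] that by (simp add: I_def)

  have scherk_f: "is_scherk1 (graph_surface \<Omega> f)"
  proof (rule is_scherk1_graph_surface[OF anz R, of _ _ "- C" b])
    fix z assume "z \<in> \<Omega>"
    then show "sin (cmod a * (f z - - C)) = 2 * Re (1 / a * exp (a * z + b)) / R"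
      "sin (cmod a * (f z - - C)) \<noteq> 0"
      using sinE[of z] sinnz[of "f z"] by (simp_all add: I_def \<theta>_def E_def \<omega>_def)
  qed
  have scherk_gf: "is_scherk1 (graph_surface \<Omega> (g \<circ> f))"
  proof -
    \<comment> \<open>For \<open>\<epsilon> = -1\<close> the sign is absorbed by a vertical shift of half a period.\<close>
    define d where "d = (if \<epsilon> = 1 then D else D - pi / \<omega>)"
    have sin_gf: "sin (cmod a * ((g \<circ> f) z - d)) = E z / (R * M)" if z: "z \<in> \<Omega>" for z
    proof -
      have "\<bar>E z / (R * M)\<bar> \<le> 1"
        using sM1[of "f z"] sinE[OF z] z by (simp add: I_def)
      then have sa: "sin (arcsin (E z / (R * M))) = E z / (R * M)"
        by (intro sin_arcsin) linarith+
      have "\<omega> * (g (f z) - D) = \<epsilon> * arcsin (E z / (R * M))"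
        unfolding gf_eq[OF z] using w by simp
      moreover have "\<omega> * (g (f z) - d) = \<omega> * (g (f z) - D) + (if \<epsilon> = 1 then 0 else pi)"
        using w by (simp add: d_def algebra_simps)
      ultimately show ?thesis
        using \<epsilon> sa by (auto simp: \<omega>_def[symmetric])
    qed
    show ?thesis
    proof (rule is_scherk1_graph_surface[OF anz mult_pos_pos[OF R M], of _ _ d b])
      fix z assume z: "z \<in> \<Omega>"
      show "sin (cmod a * ((g \<circ> f) z - d)) = 2 * Re (1 / a * exp (a * z + b)) / (R * M)"
        using sin_gf[OF z] by (simp add: E_def)
      have "E z \<noteq> 0" using sinnz[of "f z"] sinE[OF z] z by (auto simp: I_def)
      then show "sin (cmod a * ((g \<circ> f) z - d)) \<noteq> 0"
        unfolding sin_gf[OF z] using R M by simp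
    qed
  qed

  \<comment> \<open>The statement contains \<open>C3\<close> and \<open>C5\<close> only through
    squares, so the positive numbers \<open>R\<close> and \<open>M\<close> enter by their square
    roots.\<close>
  have sq: "(sqrt R)\<^sup>2 = R" "(sqrt M)\<^sup>2 = M" "(sqrt R * sqrt M)\<^sup>2 = R * M"
    using R M by (simp_all add: power_mult_distrib)
  show ?thesis
    unfolding I_def[symmetric]
  proof (rule exI[of _ a], rule exI[of _ b], rule exI[of _ C], rule exI[of _ D],
      rule exI[of _ "sqrt R"], rule exI[of _ "sqrt M"], rule exI[of _ \<epsilon>],
      unfold sq \<omega>_def[symmetric], intro conjI ballI)
    show "a \<noteq> 0" "sqrt R \<noteq> 0" "sqrt M \<noteq> 0" "\<epsilon> \<in> {1, -1}"
      using anz R M \<epsilon> by simp_all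
    fix z assume z: "z \<in> \<Omega>"
    then have fz: "f z \<in> I" by (simp add: I_def)
    have "\<bar>E z / R\<bar> \<le> 1" "\<bar>E z / (R * M)\<bar> \<le> 1"
      using sM1[OF fz] sinE[OF z] abs_sin_le_one[of "\<theta> (f z)"] by simp_all
    then show "2 * Re (1 / a * exp (a * z + b)) / R \<in> {-1..1}"
      "2 * Re (1 / a * exp (a * z + b)) / (R * M) \<in> {-1..1}"
      unfolding E_def abs_le_iff atLeastAtMost_iff by linarith+
    show "f z = 1 / \<omega> * arcsin (2 * Re (1 / a * exp (a * z + b)) / R) - C"
      using f_eq[OF z] by (simp only: E_def)
    show "(g \<circ> f) z = \<epsilon> * (1 / \<omega>) * arcsin (2 * Re (1 / a * exp (a * z + b)) / (R * M)) + D"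
      using gf_eq[OF z] by (simp add: E_def)
  next
    fix s assume s: "s \<in> I"
    show "sin (\<omega> * (s + C)) / M \<in> {-1..1}"
      using sM1[OF s] unfolding \<theta>_def abs_le_iff atLeastAtMost_iff by linarith
    show "g s = \<epsilon> * (1 / \<omega>) * arcsin (sin (\<omega> * (s + C)) / M) + D"
      using g_eq[OF s] by (simp add: \<theta>_def)
  qed (rule scherk_f scherk_gf)+
qed

end
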